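(* For $\varphi\in L^\infty(\mathbb{T})$, the operator $D_\varphi^{\mathcal{M}}$ satisfies, on $\mathcal{M}^\perp$, $$S_{\mathcal{M}^\perp}^*D_\varphi^{\mathcal{M}}S_{\mathcal{M}^\perp}-D_\varphi^{\mathcal{M}}=\Delta_1+\Delta_2,$$ where $$\Delta_1=-P_{\mathcal{M}^\perp}(\bar z h)\otimes\bar z\bar\varphi h+P_{\mathcal{M}^\perp}(\bar z hu)\otimes\bar z\bar\varphi hu$$ and $$\Delta_2=-S_{\mathcal{M}^\perp}^*P_{\mathcal{M}^\perp}(\varphi h)\otimes\bar z h+S_{\mathcal{M}^\perp}^*P_{\mathcal{M}^\perp}(\varphi hu)\otimes\bar z hu.$$ Consequently, $$\operatorname{rank}\left(S_{\mathcal{M}^\perp}^*D_\varphi^{\mathcal{M}}S_{\mathcal{M}^\perp}-D_\varphi^{\mathcal{M}}\right)\le4.$$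
   Context: $\mathbb{D}$ is the open unit disk, $\mathbb{T}=\partial\mathbb{D}$, and $L^2(\mathbb{T})$ is taken with respect to normalized Lebesgue measure $m$, with inner product linear in the first variable. $H^2\subset L^2(\mathbb{T})$ is the Hardy space (functions with vanishing negative Fourier coefficients, also viewed as analytic functions on $\mathbb{D}$). For $f\in H^2$, $S^*f=(f-f(0))/z$. For an inner function $u$, $\mathcal{K}_u=H^2\ominus uH^2$. A closed subspace $\mathcal{M}\subset H^2$ is nearly $S^*$-invariant if $f\in\mathcal{M}$, $f(0)=0$ imply $S^*f\in\mathcal{M}$. Setting: $\mathcal{M}=h\mathcal{K}_u$ is a nonzero proper closed nearly $S^*$-invariant subspace of $H^2$, where $u$ is a nonconstant inner function with $u(0)=0$ and $h\in\mathcal{M}$ is the extremal function of $\mathcal{M}$: $\|h\|_2=1$, $h(0)>0$, $h\perp\{f\in\mathcal{M}:f(0)=0\}$, and multiplication by $h$ is an isometry from $\mathcal{K}_u$ onto $\mathcal{M}$. $\mathcal{M}^\perp=L^2(\mathbb{T})\ominus\mathcal{M}$, and $P_{\mathcal{M}^\perp}$ is the orthogonal projection of $L^2(\mathbb{T})$ onto it. $M_\varphi f=\varphi f$ on $L^2(\mathbb{T})$, and $D_\varphi^{\mathcal{M}}=P_{\mathcal{M}^\perp}M_\varphi|_{\mathcal{M}^\perp}:\mathcal{M}^\perp\to\mathcal{M}^\perp$. $S_{\mathcal{M}^\perp}=P_{\mathcal{M}^\perp}M_z|_{\mathcal{M}^\perp}=D_z^{\mathcal{M}}$, whose adjoint is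 $S_{\mathcal{M}^\perp}^*=P_{\mathcal{M}^\perp}M_{\bar z}|_{\mathcal{M}^\perp}$. For $a,b\in L^2(\mathbb{T})$, $(a\otimes b)x=\langle x,b\rangle a$ with the $L^2(\mathbb{T})$ inner product; here $\Delta_1,\Delta_2$ act on $x\in\mathcal{M}^\perp$. A product such as $S_{\mathcal{M}^\perp}^*P_{\mathcal{M}^\perp}(\varphi h)\otimes\bar z h$ means $\big(S_{\mathcal{M}^\perp}^*P_{\mathcal{M}^\perp}(\varphi h)\big)\otimes(\bar z h)$, and similarly for the others. *)

theory Defs
  imports "HOL-Analysis.Analysis" "HOL-Library.Extended_Nat"
begin

section \<open>The Hilbert space \<open>L\<^sup>2\<close> of the unit circle\<close>

text \<open>The normalized Lebesgue measure on the unit circle: the law of \<open>cis t\<close> for \<open>t\<close> uniform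
  on \<open>[0, 2\<pi>)\<close>.\<close>

definition circle_measure :: "complex measure" where
  "circle_measure =
     distr (uniform_measure lborel {0..<2 * pi}) (restrict_space borel (sphere 0 1)) cis"

definition square_integrable :: "(complex \<Rightarrow> complex) \<Rightarrow> bool" where
  "square_integrable f \<longleftrightarrow>
     f \<in> borel_measurable circle_measure \<and> integrable circle_measure (\<lambda>z. (cmod (f z))\<^sup>2)"

definition L_infinity :: "(complex \<Rightarrow> complex) set" where
  "L_infinity =
     {\<phi> \<in> borel_measurable circle_measure. \<exists>C. AE z in circle_measure. cmod (\<phi> z) \<le> C}"

lemma square_integrable_zero: "square_integrable (\<lambda>_. 0)"
  by (simp add: square_integrable_def)

quotient_type L2T = "complex \<Rightarrow> complex" / partial:
  "\<lambda>f g. square_integrable f \<and> square_integrable g \<and> (AE z in circle_measure. f z = g z)"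
  morphisms rep_L2T abs_L2T
proof (rule part_equivpI)
  show "\<exists>f. square_integrable f \<and> square_integrable f \<and> (AE z in circle_measure. f z = f z)"
    using square_integrable_zero by auto
  show "symp (\<lambda>f g. square_integrable f \<and> square_integrable g \<and>
          (AE z in circle_measure. f z = g z))"
    by (rule sympI) auto
  show "transp (\<lambda>f g. square_integrable f \<and> square_integrable g \<and>
          (AE z in circle_measure. f z = g z))"
    by (rule transpI) auto
qed

lemma square_integrable_measurable:
  "square_integrable f \<Longrightarrow> f \<in> borel_measurable circle_measure"
  by (simp add: square_integrable_def)

lemma square_integrable_mult_integrable:
  assumes "square_integrable f" "square_integrable g"
  shows "integrable circle_measure (\<lambda>z. f z * cnj (g z))"
proof (rule Bochner_Integration.integrable_bound)
  show "integrable circle_measure (\<lambda>z. (cmod (f z))\<^sup>2 + (cmod (g z))\<^sup>2)"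
    using assms by (simp add: square_integrable_def)
  have [measurable]: "f \<in> borel_measurable circle_measure" "g \<in> borel_measurable circle_measure"
    using assms by (auto simp: square_integrable_def)
  have [measurable]: "(\<lambda>z. cnj (g z)) \<in> borel_measurable circle_measure"
    by (rule borel_measurable_continuous_on[where f = cnj]) (auto intro: continuous_intros)
  show "(\<lambda>z. f z * cnj (g z)) \<in> borel_measurable circle_measure" by measurable
  have "cmod (f z * cnj (g z)) \<le> (cmod (f z))\<^sup>2 + (cmod (g z))\<^sup>2" for z
  proof -
    have "2 * (cmod (f z) * cmod (g z)) \<le> (cmod (f z))\<^sup>2 + (cmod (g z))\<^sup>2"
      using sum_squares_bound[of "cmod (f z)" "cmod (g z)"] by (simp add: mult.assoc)
    moreover have "0 \<le> cmod (f z) * cmod (g z)" by simp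
    ultimately have "cmod (f z) * cmod (g z) \<le> (cmod (f z))\<^sup>2 + (cmod (g z))\<^sup>2" by linarith
    then show ?thesis by (simp add: norm_mult)
  qed
  then show "AE z in circle_measure.
      norm (f z * cnj (g z)) \<le> norm ((cmod (f z))\<^sup>2 + (cmod (g z))\<^sup>2)"
    by auto
qed

lemma square_integrable_scale:
  assumes "square_integrable f"
  shows "square_integrable (\<lambda>z. c * f z)"
  using assms by (auto simp: square_integrable_def norm_mult power_mult_distrib)

lemma square_integrable_add:
  assumes "square_integrable f" "square_integrable g"
  shows "square_integrable (\<lambda>z. f z + g z)"
  unfolding square_integrable_def
proof
  have [measurable]: "f \<in> borel_measurable circle_measure" "g \<in> borel_measurable circle_measure"
    using assms by (auto simp: square_integrable_def)
  show "(\<lambda>z. f z + g z) \<in> borel_measurable circle_measure" by measurable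
  show "integrable circle_measure (\<lambda>z. (cmod (f z + g z))\<^sup>2)"
  proof (rule Bochner_Integration.integrable_bound)
    show "integrable circle_measure (\<lambda>z. 2 * (cmod (f z))\<^sup>2 + 2 * (cmod (g z))\<^sup>2)"
      using assms by (simp add: square_integrable_def)
    show "(\<lambda>z. (cmod (f z + g z))\<^sup>2) \<in> borel_measurable circle_measure" by measurable
    have "(cmod (f z + g z))\<^sup>2 \<le> 2 * (cmod (f z))\<^sup>2 + 2 * (cmod (g z))\<^sup>2" for z
    proof -
      have "(cmod (f z + g z))\<^sup>2 \<le> (cmod (f z) + cmod (g z))\<^sup>2"
        by (intro power_mono norm_triangle_ineq) auto
      then show ?thesis
        using sum_squares_bound[of "cmod (f z)" "cmod (g z)"]
        by (simp add: power2_sum)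
    qed
    then show "AE z in circle_measure. norm ((cmod (f z + g z))\<^sup>2)
        \<le> norm (2 * (cmod (f z))\<^sup>2 + 2 * (cmod (g z))\<^sup>2)"
      by auto
  qed
qed

lift_definition cscale :: "complex \<Rightarrow> L2T \<Rightarrow> L2T" is "\<lambda>c f z. c * f z"
  by (auto intro: square_integrable_scale)

lemma borel_measurable_mult_cnj:
  assumes "f \<in> borel_measurable M" "g \<in> borel_measurable M"
  shows "(\<lambda>z. f z * cnj (g z) :: complex) \<in> borel_measurable M"
proof -
  have "(\<lambda>z. cnj (g z)) \<in> borel_measurable M"
    by (rule borel_measurable_continuous_on[where f = cnj])
       (use assms in \<open>auto intro: continuous_intros\<close>)
  with assms show ?thesis by measurable
qed

lift_definition cip :: "L2T \<Rightarrow> L2T \<Rightarrow> complex" is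
  "\<lambda>f g. \<integral>z. f z * cnj (g z) \<partial>circle_measure"
  by (rule integral_cong_AE)
     (auto intro: borel_measurable_mult_cnj dest: square_integrable_measurable)

instantiation L2T :: real_inner
begin

lift_definition zero_L2T :: L2T is "\<lambda>_. 0"
  by (simp add: square_integrable_zero)

lift_definition plus_L2T :: "L2T \<Rightarrow> L2T \<Rightarrow> L2T" is "\<lambda>f g z. f z + g z"
  by (auto intro: square_integrable_add)

definition uminus_L2T :: "L2T \<Rightarrow> L2T" where "uminus_L2T f = cscale (- 1) f"

definition minus_L2T :: "L2T \<Rightarrow> L2T \<Rightarrow> L2T" where "minus_L2T f g = f + - (g :: L2T)"

definition scaleR_L2T :: "real \<Rightarrow> L2T \<Rightarrow> L2T" where "scaleR_L2T r f = cscale (complex_of_real r) f"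

definition inner_L2T :: "L2T \<Rightarrow> L2T \<Rightarrow> real" where "inner_L2T f g = Re (cip f g)"

lift_definition norm_L2T :: "L2T \<Rightarrow> real" is
  "\<lambda>f. sqrt (\<integral>z. (cmod (f z))\<^sup>2 \<partial>circle_measure)"
  by (rule arg_cong[where f = sqrt], rule integral_cong_AE)
     (auto simp: square_integrable_def)

definition dist_L2T :: "L2T \<Rightarrow> L2T \<Rightarrow> real" where "dist_L2T f g = norm (f - g)"

definition sgn_L2T :: "L2T \<Rightarrow> L2T" where "sgn_L2T f = inverse (norm f) *\<^sub>R f"

definition uniformity_L2T :: "(L2T \<times> L2T) filter" where
  "uniformity_L2T = (INF e\<in>{0 <..}. principal {(f, g). dist f g < e})"

definition open_L2T :: "L2T set \<Rightarrow> bool" where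
  "open_L2T U \<longleftrightarrow> (\<forall>f\<in>U. eventually (\<lambda>(f', g). f' = f \<longrightarrow> g \<in> U) uniformity)"

instance
proof
  fix f g k :: L2T and r s :: real and U :: "L2T set"
  show "f + g + k = f + (g + k)"
    by transfer (auto simp: add.assoc intro!: square_integrable_add)
  show "f + g = g + f"
    by transfer (auto simp: add.commute intro!: square_integrable_add)
  show "0 + f = f" by transfer auto
  show "- f + f = 0"
    unfolding uminus_L2T_def
    by transfer (auto intro!: square_integrable_zero square_integrable_add
        square_integrable_scale[of _ "-1", simplified])
  show "f - g = f + - g" by (rule minus_L2T_def)
  show "r *\<^sub>R (f + g) = r *\<^sub>R f + r *\<^sub>R g"
    unfolding scaleR_L2T_def
    by transfer (auto simp: distrib_left intro!: square_integrable_add square_integrable_scale)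
  show "(r + s) *\<^sub>R f = r *\<^sub>R f + s *\<^sub>R f"
    unfolding scaleR_L2T_def
    by transfer (auto simp: distrib_right intro!: square_integrable_add square_integrable_scale)
  show "r *\<^sub>R s *\<^sub>R f = (r * s) *\<^sub>R f"
    unfolding scaleR_L2T_def
    by transfer (auto simp: mult.assoc intro!: square_integrable_scale)
  show "1 *\<^sub>R f = f" unfolding scaleR_L2T_def by transfer auto
  show "dist f g = norm (f - g)" by (rule dist_L2T_def)
  show "sgn f = inverse (norm f) *\<^sub>R f" by (rule sgn_L2T_def)
  show "uniformity = (INF e\<in>{0 <..}. principal {(f, g). dist f (g :: L2T) < e})"
    by (rule uniformity_L2T_def)
  show "open U \<longleftrightarrow> (\<forall>f\<in>U. eventually (\<lambda>(f', g). f' = f \<longrightarrow> g \<in> U) uniformity)"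
    by (rule open_L2T_def)
  show "inner f g = inner g f"
  proof -
    have "cip f g = cnj (cip g f)"
      by transfer (simp add: mult.commute flip: Bochner_Integration.integral_cnj)
    then show ?thesis by (simp add: inner_L2T_def)
  qed
  show "inner (f + g) k = inner f k + inner g k"
  proof -
    have "cip (f + g) k = cip f k + cip g k"
      by transfer (simp add: distrib_right square_integrable_mult_integrable)
    then show ?thesis by (simp add: inner_L2T_def)
  qed
  show "inner (r *\<^sub>R f) g = r * inner f g"
  proof -
    have "cip (r *\<^sub>R f) g = of_real r * cip f g"
      unfolding scaleR_L2T_def by transfer (simp add: mult.assoc)
    then show ?thesis by (simp add: inner_L2T_def)
  qed
  have cip_self: "cip f f = of_real ((norm f)\<^sup>2)"
    by transfer (simp add: complex_norm_square[symmetric] flip: of_real_power)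
  show "0 \<le> inner f f" by (simp add: inner_L2T_def cip_self)
  have norm_nonneg: "0 \<le> norm f" by transfer simp
  show "norm f = sqrt (inner f f)" using norm_nonneg by (simp add: inner_L2T_def cip_self)
  have "norm f = 0 \<longleftrightarrow> f = 0"
  proof (transfer, goal_cases)
    case (1 f)
    then have "integrable circle_measure (\<lambda>z. (cmod (f z))\<^sup>2)"
      by (simp add: square_integrable_def)
    then have "(\<integral>z. (cmod (f z))\<^sup>2 \<partial>circle_measure) = 0 \<longleftrightarrow>
        (AE z in circle_measure. (cmod (f z))\<^sup>2 = 0)"
      by (intro integral_nonneg_eq_0_iff_AE) auto
    with 1 show ?case by (simp add: square_integrable_zero)
  qed
  then show "inner f f = 0 \<longleftrightarrow> f = 0" by (simp add: inner_L2T_def cip_self)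
qed

end

global_interpretation L2T: vector_space cscale
proof
  fix a b :: complex and f g :: L2T
  show "cscale a (f + g) = cscale a f + cscale a g"
    by transfer (auto simp: distrib_left intro!: square_integrable_add square_integrable_scale)
  show "cscale (a + b) f = cscale a f + cscale b f"
    by transfer (auto simp: distrib_right intro!: square_integrable_add square_integrable_scale)
  show "cscale a (cscale b f) = cscale (a * b) f"
    by transfer (auto simp: mult.assoc intro!: square_integrable_scale)
  show "cscale 1 f = f" by transfer auto
qed


section \<open>Operators on \<open>L\<^sup>2\<close>\<close>

text \<open>The class of \<open>f\<close>, with the junk value \<open>0\<close> if \<open>f\<close> is not square integrable.\<close>

lift_definition to_L2T :: "(complex \<Rightarrow> complex) \<Rightarrow> L2T" is
  "\<lambda>f. if square_integrable f then f else (\<lambda>_. 0)"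
  by (simp add: square_integrable_zero)

text \<open>Multiplication by \<open>\<phi>\<close>. For \<open>\<phi> \<in> L_infinity\<close> the product is always square integrable; for
  other \<open>\<phi>\<close> the value is the product only where that product is square integrable.\<close>

definition mult_op :: "(complex \<Rightarrow> complex) \<Rightarrow> L2T \<Rightarrow> L2T" where
  "mult_op \<phi> f = to_L2T (\<lambda>z. \<phi> z * rep_L2T f z)"

text \<open>The orthogonal complement \<open>L\<^sup>2 \<ominus> A\<close>.\<close>

definition ortho_compl :: "L2T set \<Rightarrow> L2T set" where
  "ortho_compl A = {f. \<forall>g\<in>A. cip f g = 0}"

text \<open>The orthogonal projection onto a closed complex subspace \<open>A\<close>.\<close>

definition ortho_proj :: "L2T set \<Rightarrow> L2T \<Rightarrow> L2T" where
  "ortho_proj A f = (THE g. g \<in> A \<and> f - g \<in> ortho_compl A)"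

text \<open>The Hilbert space adjoint of an operator \<open>A \<rightarrow> A\<close> on a closed complex subspace \<open>A\<close>.\<close>

definition adjoint_on :: "L2T set \<Rightarrow> (L2T \<Rightarrow> L2T) \<Rightarrow> L2T \<Rightarrow> L2T" where
  "adjoint_on A T y = (THE w. w \<in> A \<and> (\<forall>x\<in>A. cip (T x) y = cip x w))"

definition rank_one :: "L2T \<Rightarrow> L2T \<Rightarrow> L2T \<Rightarrow> L2T" where
  "rank_one a b x = cscale (cip x b) a"

text \<open>The complex dimension of the range \<open>T ` A\<close>. The case distinction is needed because
  \<open>L2T.dim\<close> is \<open>0\<close> on infinite-dimensional spaces.\<close>

definition rank_on :: "L2T set \<Rightarrow> (L2T \<Rightarrow> L2T) \<Rightarrow> enat" where
  "rank_on A T =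
     (if \<exists>B. finite B \<and> T ` A \<subseteq> L2T.span B then enat (L2T.dim (T ` A)) else \<infinity>)"


section \<open>Hardy space, model spaces, nearly invariant subspaces\<close>

lemma measurable_powi_circle: "(\<lambda>z. z powi n) \<in> borel_measurable circle_measure"
  unfolding circle_measure_def measurable_distr_eq1
  by (rule borel_measurable_continuous_on_restrict) (auto intro!: continuous_intros)

lift_definition fourier_coeff :: "L2T \<Rightarrow> int \<Rightarrow> complex" is
  "\<lambda>f n. \<integral>z. f z * cnj (z powi n) \<partial>circle_measure"
proof (rule ext, rule integral_cong_AE, goal_cases)
  case (1 f g n)
  then show ?case
    by (intro borel_measurable_mult_cnj measurable_powi_circle)
       (auto dest: square_integrable_measurable)
next
  case (2 f g n)
  then show ?case
    by (intro borel_measurable_mult_cnj measurable_powi_circle)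
       (auto dest: square_integrable_measurable)
next
  case (3 f g n)
  then show ?case by auto
qed

definition H2 :: "L2T set" where
  "H2 = {f. \<forall>n<0. fourier_coeff f n = 0}"

text \<open>The value at a point \<open>w\<close> of the open unit disk of the analytic function given by \<open>f \<in> H2\<close>.\<close>

definition hardy_eval :: "L2T \<Rightarrow> complex \<Rightarrow> complex" where
  "hardy_eval f w = (\<Sum>n. fourier_coeff f (int n) * w ^ n)"

definition backward_shift :: "L2T \<Rightarrow> L2T" where
  "backward_shift f = mult_op (\<lambda>z. 1 / z) (f - to_L2T (\<lambda>_. hardy_eval f 0))"

text \<open>Inner functions are given by their boundary values.\<close>

definition inner_function :: "(complex \<Rightarrow> complex) \<Rightarrow> bool" where
  "inner_function u \<longleftrightarrow>
     u \<in> L_infinity \<and> to_L2T u \<in> H2 \<and> (AE z in circle_measure. cmod (u z) = 1)"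

definition model_space :: "(complex \<Rightarrow> complex) \<Rightarrow> L2T set" where
  "model_space u = H2 \<inter> ortho_compl (mult_op u ` H2)"

definition nearly_invariant :: "L2T set \<Rightarrow> bool" where
  "nearly_invariant M \<longleftrightarrow>
     M \<subseteq> H2 \<and> L2T.subspace M \<and> closed M \<and>
     (\<forall>f\<in>M. hardy_eval f 0 = 0 \<longrightarrow> backward_shift f \<in> M)"

definition extremal_function :: "L2T set \<Rightarrow> L2T \<Rightarrow> bool" where
  "extremal_function M h \<longleftrightarrow>
     h \<in> M \<and> norm h = 1 \<and> Im (hardy_eval h 0) = 0 \<and> Re (hardy_eval h 0) > 0 \<and>
     (\<forall>f\<in>M. hardy_eval f 0 = 0 \<longrightarrow> cip h f = 0)"

text \<open>Multiplication by \<open>h\<close>, a priori only a map into the integrable functions, is an isometry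
  from \<open>K\<close> onto \<open>M\<close>.\<close>

definition isometric_multiplier :: "L2T \<Rightarrow> L2T set \<Rightarrow> L2T set \<Rightarrow> bool" where
  "isometric_multiplier h K M \<longleftrightarrow>
     (\<forall>f\<in>K. square_integrable (\<lambda>z. rep_L2T h z * rep_L2T f z) \<and>
            norm (mult_op (rep_L2T h) f) = norm f) \<and>
     mult_op (rep_L2T h) ` K = M"


section \<open>Dual operators on the orthogonal complement\<close>

definition compl_proj :: "L2T set \<Rightarrow> L2T \<Rightarrow> L2T" where
  "compl_proj M = ortho_proj (ortho_compl M)"

text \<open>\<open>dual_op M \<phi>\<close> and \<open>dual_shift M\<close> are meant as operators on \<open>ortho_compl M\<close>.\<close>

definition dual_op :: "L2T set \<Rightarrow> (complex \<Rightarrow> complex) \<Rightarrow> L2T \<Rightarrow> L2T" where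
  "dual_op M \<phi> x = compl_proj M (mult_op \<phi> x)"

definition dual_shift :: "L2T set \<Rightarrow> L2T \<Rightarrow> L2T" where
  "dual_shift M = dual_op M (\<lambda>z. z)"

definition dual_shift_adj :: "L2T set \<Rightarrow> L2T \<Rightarrow> L2T" where
  "dual_shift_adj M = adjoint_on (ortho_compl M) (dual_shift M)"

end

theory Submission
  imports Defs
begin

text \<open>
  Write \<open>P\<close> for the projection onto \<open>M\<^sup>\<bottom>\<close>. The commutation of multiplication operators turns
  \<open>P \<cdot> cnj z \<cdot> \<phi> \<cdot> z\<close> into \<open>P \<cdot> \<phi>\<close>, so the defect of \<open>D\<close> comes only from the two inner
  occurrences of \<open>P\<close> in \<open>Sa D S x = P (cnj z \<cdot> P (\<phi> \<cdot> P (z x)))\<close>, that is, from the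
  components along \<open>M\<close> of \<open>z x\<close> and of \<open>\<phi> z x\<close>.

  Both components are controlled by one fact (\<open>conj_mult_in\<close>): the part of \<open>M\<close> orthogonal to the
  extremal function \<open>h\<close> is \<open>{m \<in> M. m(0) = 0}\<close>, and near invariance says that multiplication by
  \<open>cnj z\<close> maps it into \<open>M\<close>. Dually, for \<open>x \<in> M\<^sup>\<bottom>\<close> the component of \<open>z x\<close> along \<open>M\<close> is orthogonal to
  that part, hence is a multiple of \<open>h\<close> (\<open>dual_shift_eq\<close>); this gives the term of \<open>\<Delta>2\<close> with
  \<open>\<phi> h\<close>. The component of \<open>y = \<phi> z x\<close> along \<open>M\<close> is \<open>\<langle>y, h\<rangle> h\<close> plus something that
  \<open>P \<cdot> cnj z\<close> kills (\<open>compl_proj_conj_proj\<close>); this gives the term of \<open>\<Delta>1\<close> with \<open>cnj z h\<close>.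

  The two terms with \<open>u\<close> vanish on \<open>M\<^sup>\<bottom>\<close>. Since \<open>u(0) = 0\<close>, the function \<open>cnj z u\<close> lies in the model
  space of \<open>u\<close>, so \<open>cnj z u h \<in> M\<close>: it is killed by \<open>P\<close> and orthogonal to every \<open>x \<in> M\<^sup>\<bottom>\<close>.

  For \<open>P\<close> to be a genuine projection, \<open>L\<^sup>2\<close> has to be complete (\<open>L2T_Cauchy_convergent\<close>), which is
  proved by the argument of Riesz and Fischer.
\<close>

section \<open>Representatives of classes in \<open>L\<^sup>2\<close>\<close>

lemma square_integrable_rep: "square_integrable (rep_L2T f)"
  using Quotient_rep_reflp[OF Quotient_L2T, of f] by simp

lemma rep_measurable [measurable]: "rep_L2T f \<in> borel_measurable circle_measure"
  by (rule square_integrable_measurable[OF square_integrable_rep])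

lemma L2T_eq_iff: "f = g \<longleftrightarrow> (AE z in circle_measure. rep_L2T f z = rep_L2T g z)"
  using Quotient_rel_rep[OF Quotient_L2T, of f g] by (simp add: square_integrable_rep)

lemma rep_abs:
  "square_integrable f \<Longrightarrow> AE z in circle_measure. rep_L2T (abs_L2T f) z = f z"
  using Quotient_rep_abs[OF Quotient_L2T, of f] by simp

lemma rep_to_L2T:
  "square_integrable f \<Longrightarrow> AE z in circle_measure. rep_L2T (to_L2T f) z = f z"
  by (simp add: to_L2T_def rep_abs)

lemma rep_plus: "AE z in circle_measure. rep_L2T (f + g) z = rep_L2T f z + rep_L2T g z"
  unfolding plus_L2T_def map_fun_def o_def id_def
  by (intro rep_abs square_integrable_add square_integrable_rep)

lemma rep_cscale: "AE z in circle_measure. rep_L2T (cscale c f) z = c * rep_L2T f z"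
  unfolding cscale_def map_fun_def o_def id_def
  by (intro rep_abs square_integrable_scale square_integrable_rep)

lemma rep_minus: "AE z in circle_measure. rep_L2T (f - g) z = rep_L2T f z - rep_L2T g z"
  unfolding minus_L2T_def uminus_L2T_def
  using rep_plus[of f "cscale (- 1) g"] rep_cscale[of "- 1" g] by eventually_elim simp

lemma cip_eq_integral: "cip f g = (\<integral>z. rep_L2T f z * cnj (rep_L2T g z) \<partial>circle_measure)"
  by (simp add: cip_def)

lemma norm_eq_integral: "norm f = sqrt (\<integral>z. (cmod (rep_L2T f z))\<^sup>2 \<partial>circle_measure)"
  by (simp add: norm_L2T_def)

lemma fourier_coeff_eq_integral:
  "fourier_coeff f n = (\<integral>z. rep_L2T f z * cnj (z powi n) \<partial>circle_measure)"
  by (simp add: fourier_coeff_def)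

lemma AE_circle_norm: "AE z in circle_measure. cmod z = 1"
  by (rule AE_I2) (simp add: circle_measure_def space_restrict_space)

lemma emeasure_circle: "emeasure circle_measure (space circle_measure) = 1"
proof -
  have "cis \<in> borel \<rightarrow>\<^sub>M restrict_space borel (sphere 0 1)"
    by (rule measurable_restrict_space2) (auto intro!: borel_measurable_continuous_onI continuous_intros)
  then have m: "cis \<in> uniform_measure lborel {0..<2 * pi} \<rightarrow>\<^sub>M restrict_space borel (sphere 0 1)"
    by (simp add: measurable_def)
  have sp: "space (restrict_space borel (sphere 0 1)) = (sphere 0 1 :: complex set)"
    by (simp add: space_restrict_space)
  have "emeasure circle_measure (space circle_measure)
      = emeasure (uniform_measure lborel {0..<2 * pi}) (cis -` sphere 0 1)"
    unfolding circle_measure_def space_distr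
    by (subst emeasure_distr[OF m sets.top]) (simp add: sp)
  also have "cis -` sphere 0 1 = UNIV"
    by auto
  also have "emeasure (uniform_measure lborel {0..<2 * pi}) UNIV = 1"
    by (subst emeasure_uniform_measure) auto
  finally show ?thesis .
qed

lemma square_integrable_one: "square_integrable (\<lambda>_. 1)"
  by (auto simp: square_integrable_def integrable_iff_bounded emeasure_circle)

section \<open>The complex inner product\<close>

lemma cip_add_left: "cip (f + g) k = cip f k + cip g k"
  by transfer (simp add: distrib_right square_integrable_mult_integrable)

lemma cip_cscale_left: "cip (cscale c f) g = c * cip f g"
  by transfer (simp add: mult.assoc)

lemma cip_commute: "cip f g = cnj (cip g f)"
  by transfer (simp add: mult.commute flip: Bochner_Integration.integral_cnj)

lemma cip_diff_left: "cip (f - g) k = cip f k - cip g k"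
  unfolding minus_L2T_def uminus_L2T_def cip_add_left cip_cscale_left by simp

lemma cip_cscale_right: "cip f (cscale c g) = cnj c * cip f g"
  using cip_commute[of f g] cip_commute[of f "cscale c g"] by (simp add: cip_cscale_left)

lemma cip_diff_right: "cip f (g - k) = cip f g - cip f k"
  using cip_commute[of f g] cip_commute[of f k] cip_commute[of f "g - k"] by (simp add: cip_diff_left)

lemma cip_self: "cip f f = of_real ((norm f)\<^sup>2)"
  by transfer (simp add: complex_norm_square[symmetric] flip: of_real_power)

lemma cip_self_eq_0: "cip f f = 0 \<Longrightarrow> f = 0"
  by (simp add: cip_self)

lemma cip_eq_0_commute: "cip f g = 0 \<Longrightarrow> cip g f = 0"
  using cip_commute[of g f] by simp

lemma subspace_ortho_compl: "L2T.subspace (ortho_compl A)"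
proof -
  have "cip 0 g = 0" for g
    using cip_diff_left[of 0 0 g] by simp
  then show ?thesis
    by (auto simp: L2T.subspace_def ortho_compl_def cip_add_left cip_cscale_left)
qed

section \<open>Multiplication by bounded functions\<close>

lemma L_infinity_measurable: "\<phi> \<in> L_infinity \<Longrightarrow> \<phi> \<in> borel_measurable circle_measure"
  by (simp add: L_infinity_def)

lemma L_infinity_mult:
  assumes "\<phi> \<in> L_infinity" "\<psi> \<in> L_infinity"
  shows "(\<lambda>z. \<phi> z * \<psi> z) \<in> L_infinity"
proof -
  obtain C D where C: "AE z in circle_measure. cmod (\<phi> z) \<le> C"
    and D: "AE z in circle_measure. cmod (\<psi> z) \<le> D"
    using assms by (auto simp: L_infinity_def)
  have "AE z in circle_measure. cmod (\<phi> z * \<psi> z) \<le> C * D"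
    using C D
  proof eventually_elim
    case (elim z)
    have "0 \<le> C" using elim(1) norm_ge_zero order_trans by blast
    with elim show ?case by (simp add: norm_mult mult_mono)
  qed
  moreover have "(\<lambda>z. \<phi> z * \<psi> z) \<in> borel_measurable circle_measure"
    using assms[THEN L_infinity_measurable] by measurable
  ultimately show ?thesis by (auto simp: L_infinity_def)
qed

lemma L_infinity_cnj:
  assumes "\<phi> \<in> L_infinity"
  shows "(\<lambda>z. cnj (\<phi> z)) \<in> L_infinity"
  using borel_measurable_mult_cnj[of "\<lambda>_. 1" circle_measure \<phi>] assms
  by (auto simp: L_infinity_def)

lemma L_infinity_id: "(\<lambda>z. z) \<in> L_infinity"
proof -
  have "(\<lambda>z. z) \<in> borel_measurable circle_measure"
    using measurable_powi_circle[of 1] by simp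
  moreover have "AE z in circle_measure. cmod z \<le> 1"
    using AE_circle_norm by eventually_elim simp
  ultimately show ?thesis by (auto simp: L_infinity_def)
qed

lemma L_infinity_cnj_id: "cnj \<in> L_infinity"
  using L_infinity_cnj[OF L_infinity_id] by simp

lemma square_integrable_bounded_mult:
  assumes "\<phi> \<in> L_infinity" "square_integrable f"
  shows "square_integrable (\<lambda>z. \<phi> z * f z)"
proof -
  obtain C where C: "AE z in circle_measure. cmod (\<phi> z) \<le> C"
    using assms by (auto simp: L_infinity_def)
  note [measurable] = L_infinity_measurable[OF assms(1)] square_integrable_measurable[OF assms(2)]
  have "integrable circle_measure (\<lambda>z. (cmod (\<phi> z * f z))\<^sup>2)"
  proof (rule Bochner_Integration.integrable_bound)
    show "integrable circle_measure (\<lambda>z. C\<^sup>2 * (cmod (f z))\<^sup>2)"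
      using assms(2) by (simp add: square_integrable_def)
    show "(\<lambda>z. (cmod (\<phi> z * f z))\<^sup>2) \<in> borel_measurable circle_measure" by measurable
    show "AE z in circle_measure. norm ((cmod (\<phi> z * f z))\<^sup>2) \<le> norm (C\<^sup>2 * (cmod (f z))\<^sup>2)"
      using C by eventually_elim (simp add: norm_mult power_mult_distrib mult_right_mono power_mono)
  qed
  then show ?thesis by (simp add: square_integrable_def)
qed

lemma square_integrable_L_infinity: "\<phi> \<in> L_infinity \<Longrightarrow> square_integrable \<phi>"
  using square_integrable_bounded_mult[OF _ square_integrable_one] by simp

lemma rep_mult_op:
  assumes "\<phi> \<in> L_infinity"
  shows "AE z in circle_measure. rep_L2T (mult_op \<phi> f) z = \<phi> z * rep_L2T f z"
  unfolding mult_op_def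
  by (intro rep_to_L2T square_integrable_bounded_mult assms square_integrable_rep)

lemma mult_op_diff:
  assumes "\<phi> \<in> L_infinity"
  shows "mult_op \<phi> (f - g) = mult_op \<phi> f - mult_op \<phi> g"
  unfolding L2T_eq_iff
  using rep_mult_op[OF assms, of "f - g"] rep_mult_op[OF assms, of f] rep_mult_op[OF assms, of g]
    rep_minus[of f g] rep_minus[of "mult_op \<phi> f" "mult_op \<phi> g"]
  by eventually_elim (simp add: right_diff_distrib)

lemma mult_op_cscale:
  assumes "\<phi> \<in> L_infinity"
  shows "mult_op \<phi> (cscale c f) = cscale c (mult_op \<phi> f)"
  unfolding L2T_eq_iff
  using rep_mult_op[OF assms, of "cscale c f"] rep_mult_op[OF assms, of f]
    rep_cscale[of c f] rep_cscale[of c "mult_op \<phi> f"]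
  by eventually_elim simp

lemma mult_op_mult_op:
  assumes "\<phi> \<in> L_infinity" "\<psi> \<in> L_infinity"
  shows "mult_op \<phi> (mult_op \<psi> f) = mult_op (\<lambda>z. \<phi> z * \<psi> z) f"
  unfolding L2T_eq_iff
  using rep_mult_op[OF assms(1), of "mult_op \<psi> f"] rep_mult_op[OF assms(2), of f]
    rep_mult_op[OF L_infinity_mult[OF assms], of f]
  by eventually_elim simp

lemma mult_op_cong:
  assumes "\<phi> \<in> L_infinity" "\<psi> \<in> L_infinity" "AE z in circle_measure. \<phi> z = \<psi> z"
  shows "mult_op \<phi> f = mult_op \<psi> f"
  unfolding L2T_eq_iff
  using rep_mult_op[OF assms(1), of f] rep_mult_op[OF assms(2), of f] assms(3)
  by eventually_elim simp

lemma cip_mult_op_left: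
  assumes "\<phi> \<in> L_infinity"
  shows "cip (mult_op \<phi> f) g = cip f (mult_op (\<lambda>z. cnj (\<phi> z)) g)"
  unfolding cip_eq_integral
proof (rule integral_cong_AE)
  show "AE z in circle_measure. rep_L2T (mult_op \<phi> f) z * cnj (rep_L2T g z)
          = rep_L2T f z * cnj (rep_L2T (mult_op (\<lambda>z. cnj (\<phi> z)) g) z)"
    using rep_mult_op[OF assms, of f] rep_mult_op[OF L_infinity_cnj[OF assms], of g]
    by eventually_elim simp
qed (intro borel_measurable_mult_cnj rep_measurable)+

section \<open>Completeness and orthogonal projections\<close>

lemma nn_integral_norm_square:
  "(\<integral>\<^sup>+z. ennreal ((cmod (rep_L2T f z))\<^sup>2) \<partial>circle_measure) = ennreal ((norm f)\<^sup>2)"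
proof -
  have "integrable circle_measure (\<lambda>z. (cmod (rep_L2T f z))\<^sup>2)"
    using square_integrable_rep[of f] by (simp add: square_integrable_def)
  then have "(\<integral>\<^sup>+z. ennreal ((cmod (rep_L2T f z))\<^sup>2) \<partial>circle_measure)
      = ennreal (\<integral>z. (cmod (rep_L2T f z))\<^sup>2 \<partial>circle_measure)"
    by (rule nn_integral_eq_integral) simp
  then show ?thesis
    by (simp add: norm_eq_integral)
qed

text \<open>On a probability space the \<open>L\<^sup>1\<close> norm is at most the \<open>L\<^sup>2\<close> norm. Integrating
  \<open>a \<le> (c + a\<^sup>2 / c) / 2\<close> gives this in the form that the summation of the increments below needs.\<close>

lemma nn_integral_norm_le:
  assumes "norm f \<le> c" "0 < c"
  shows "(\<integral>\<^sup>+z. ennreal (cmod (rep_L2T f z)) \<partial>circle_measure) \<le> ennreal c"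
proof -
  have *: "cmod w \<le> c / 2 + (cmod w)\<^sup>2 / (2 * c)" for w
    using sum_squares_bound[of c "cmod w"] \<open>0 < c\<close> by (simp add: field_simps power2_eq_square)
  have "(\<integral>\<^sup>+z. ennreal (cmod (rep_L2T f z)) \<partial>circle_measure)
      \<le> (\<integral>\<^sup>+z. ennreal (c / 2) + ennreal (1 / (2 * c)) * ennreal ((cmod (rep_L2T f z))\<^sup>2) \<partial>circle_measure)"
    using * \<open>0 < c\<close>
    by (intro nn_integral_mono) (simp add: ennreal_mult[symmetric] ennreal_plus[symmetric] del: ennreal_plus)
  also have "\<dots> = ennreal (c / 2) + ennreal (1 / (2 * c)) * ennreal ((norm f)\<^sup>2)"
    by (subst nn_integral_add)
       (auto simp: nn_integral_cmult nn_integral_norm_square emeasure_circle)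
  also have "\<dots> = ennreal (c / 2 + 1 / (2 * c) * (norm f)\<^sup>2)"
    using \<open>0 < c\<close> by (simp add: ennreal_mult[symmetric] ennreal_plus[symmetric] del: ennreal_plus)
  also have "\<dots> \<le> ennreal (c / 2 + 1 / (2 * c) * c\<^sup>2)"
    using assms by (intro ennreal_leI add_left_mono mult_left_mono power_mono) auto
  also have "c / 2 + 1 / (2 * c) * c\<^sup>2 = c"
    using \<open>0 < c\<close> by (simp add: power2_eq_square)
  finally show ?thesis .
qed

text \<open>The increments have summable \<open>L\<^sup>1\<close> norms, so by monotone convergence they are absolutely
  summable at almost every point.\<close>

lemma fast_Cauchy_converges_AE:
  fixes X :: "nat \<Rightarrow> L2T"
  assumes "\<And>n. norm (X (Suc n) - X n) \<le> (1/2) ^ n"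
  shows "AE z in circle_measure. convergent (\<lambda>n. rep_L2T (X n) z)"
proof -
  let ?d = "\<lambda>n z. ennreal (cmod (rep_L2T (X (Suc n) - X n) z))"
  have "(\<integral>\<^sup>+z. (\<Sum>n. ?d n z) \<partial>circle_measure) = (\<Sum>n. \<integral>\<^sup>+z. ?d n z \<partial>circle_measure)"
    by (rule nn_integral_suminf) measurable
  also have "\<dots> \<le> (\<Sum>n. ennreal ((1/2) ^ n))"
    by (intro suminf_le nn_integral_norm_le assms) auto
  also have "\<dots> = ennreal (\<Sum>n. (1/2) ^ n)"
    by (intro suminf_ennreal2 summable_geometric) auto
  also have "\<dots> < \<infinity>" by simp
  finally have "AE z in circle_measure. (\<Sum>n. ?d n z) \<noteq> \<infinity>"
    by (intro nn_integral_PInf_AE) auto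
  moreover have "AE z in circle_measure. \<forall>n.
      rep_L2T (X (Suc n) - X n) z = rep_L2T (X (Suc n)) z - rep_L2T (X n) z"
    unfolding AE_all_countable by (intro allI rep_minus)
  ultimately show ?thesis
  proof eventually_elim
    case (elim z)
    then have "summable (\<lambda>n. cmod (rep_L2T (X (Suc n)) z - rep_L2T (X n) z))"
      by (intro summable_suminf_not_top) auto
    then have "summable (\<lambda>n. rep_L2T (X (Suc n)) z - rep_L2T (X n) z)"
      by (rule summable_norm_cancel)
    then have "convergent (\<lambda>n. \<Sum>i<n. rep_L2T (X (Suc i)) z - rep_L2T (X i) z)"
      by (simp add: summable_iff_convergent)
    then have "convergent (\<lambda>n. rep_L2T (X n) z - rep_L2T (X 0) z)"
      by (simp only: sum_lessThan_telescope[of "\<lambda>n. rep_L2T (X n) z"])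
    then show ?case
      using convergent_diff_const_right_iff by blast
  qed
qed

lemma Cauchy_fast_subseq:
  fixes X :: "nat \<Rightarrow> 'a::real_normed_vector"
  assumes "Cauchy X"
  obtains r where "strict_mono r" "\<And>n. norm (X (r (Suc n)) - X (r n)) \<le> (1/2) ^ n"
proof -
  have "\<forall>n. \<exists>N. \<forall>i\<ge>N. \<forall>j\<ge>N. norm (X i - X j) < (1/2) ^ n"
    using assms by (auto simp: Cauchy_iff)
  then obtain N where N: "\<And>n i j. N n \<le> i \<Longrightarrow> N n \<le> j \<Longrightarrow> norm (X i - X j) < (1/2) ^ n"
    by metis
  \<comment> \<open>The partial sums dominate each \<open>N n\<close>, and the summand \<open>n\<close> makes \<open>r\<close> strictly increasing.\<close>
  define r where "r n = n + (\<Sum>k\<le>n. N k)" for n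
  have r: "strict_mono r"
    by (rule strict_mono_Suc_iff[THEN iffD2]) (simp add: r_def)
  have "N n \<le> (\<Sum>k\<le>n. N k)" for n
    by (rule member_le_sum) auto
  then have le: "N n \<le> r n" for n
    unfolding r_def by (rule trans_le_add2)
  have "r n \<le> r (Suc n)" for n
    by (simp add: r_def)
  then have "N n \<le> r (Suc n)" for n
    using le[of n] order_trans by blast
  then show ?thesis
    using N r that le by (meson less_imp_le)
qed

text \<open>The almost everywhere limit of a fast subsequence is also its limit in norm: Fatou's lemma
  bounds the distance from a term to the limit by the distances between terms.\<close>

lemma L2T_Cauchy_convergent:
  fixes X :: "nat \<Rightarrow> L2T"
  assumes "Cauchy X"
  shows "convergent X"
proof -
  obtain r where r: "strict_mono r" "\<And>n. norm (X (r (Suc n)) - X (r n)) \<le> (1/2) ^ n"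
    using Cauchy_fast_subseq[OF assms] by blast
  define Y where "Y = X \<circ> r"
  define F where "F z = lim (\<lambda>n. rep_L2T (Y n) z)" for z
  have F_meas [measurable]: "F \<in> borel_measurable circle_measure"
    unfolding F_def by measurable
  have "AE z in circle_measure. convergent (\<lambda>n. rep_L2T (Y n) z)"
    by (rule fast_Cauchy_converges_AE) (simp add: Y_def r)
  then have lim: "AE z in circle_measure. (\<lambda>n. rep_L2T (Y n) z) \<longlonglongrightarrow> F z"
    unfolding F_def by eventually_elim (simp add: convergent_LIMSEQ_iff)
  have "Cauchy Y"
    unfolding Y_def by (rule Cauchy_subseq_Cauchy[OF assms r(1)])
  have bound: "(\<integral>\<^sup>+z. ennreal ((cmod (F z - rep_L2T (Y n) z))\<^sup>2) \<partial>circle_measure) \<le> ennreal (e\<^sup>2)"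
    if e: "\<And>m. m \<ge> N \<Longrightarrow> norm (Y m - Y n) \<le> e" for n N e
  proof -
    let ?g = "\<lambda>m z. ennreal ((cmod (rep_L2T (Y m - Y n) z))\<^sup>2)"
    have "AE z in circle_measure. \<forall>m. rep_L2T (Y m - Y n) z = rep_L2T (Y m) z - rep_L2T (Y n) z"
      unfolding AE_all_countable by (intro allI rep_minus)
    with lim have "AE z in circle_measure.
        ennreal ((cmod (F z - rep_L2T (Y n) z))\<^sup>2) = liminf (\<lambda>m. ?g m z)"
    proof eventually_elim
      case (elim z)
      have "(\<lambda>m. ?g m z) \<longlonglongrightarrow> ennreal ((cmod (F z - rep_L2T (Y n) z))\<^sup>2)"
        using elim by (auto intro!: tendsto_intros)
      then show ?case
        by (rule lim_imp_Liminf[OF trivial_limit_sequentially, symmetric])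
    qed
    then have "(\<integral>\<^sup>+z. ennreal ((cmod (F z - rep_L2T (Y n) z))\<^sup>2) \<partial>circle_measure)
        = (\<integral>\<^sup>+z. liminf (\<lambda>m. ?g m z) \<partial>circle_measure)"
      by (rule nn_integral_cong_AE)
    also have "\<dots> \<le> liminf (\<lambda>m. \<integral>\<^sup>+z. ?g m z \<partial>circle_measure)"
      by (rule nn_integral_liminf) measurable
    also have "\<dots> \<le> ennreal (e\<^sup>2)"
      unfolding nn_integral_norm_square
      by (intro Liminf_le trivial_limit_sequentially eventually_sequentiallyI[of N] ennreal_leI
          power_mono e) auto
    finally show ?thesis .
  qed
  have sq: "square_integrable (\<lambda>z. F z - rep_L2T (Y n) z)" for n
  proof -
    obtain N where N: "\<And>i j. i \<ge> N \<Longrightarrow> j \<ge> N \<Longrightarrow> norm (Y i - Y j) < 1"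
      using \<open>Cauchy Y\<close> unfolding Cauchy_iff by (metis zero_less_one)
    have "norm (Y m - Y n) \<le> 1 + norm (Y N - Y n)" if "m \<ge> N" for m
      using norm_triangle_ineq[of "Y m - Y N" "Y N - Y n"] N[OF that order_refl] by simp
    from bound[OF this]
    have "(\<integral>\<^sup>+z. ennreal ((cmod (F z - rep_L2T (Y n) z))\<^sup>2) \<partial>circle_measure) < \<infinity>"
      using ennreal_less_top le_less_trans by (metis infinity_ennreal_def)
    then show ?thesis
      by (auto simp: square_integrable_def integrable_iff_bounded)
  qed
  define G where "G = to_L2T (\<lambda>z. F z - rep_L2T (Y 0) z) + Y 0"
  have G: "AE z in circle_measure. rep_L2T (G - Y n) z = F z - rep_L2T (Y n) z" for n
    using rep_minus[of G "Y n"] rep_plus[of "to_L2T (\<lambda>z. F z - rep_L2T (Y 0) z)" "Y 0"]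
      rep_to_L2T[OF sq[of 0]]
    unfolding G_def[symmetric] by eventually_elim simp
  have norm_G: "norm (G - Y n) \<le> e" if e: "\<And>m. m \<ge> N \<Longrightarrow> norm (Y m - Y n) \<le> e" for n N e
  proof -
    have "0 \<le> e" using e[of N] norm_ge_zero order_trans by blast
    have "ennreal ((norm (G - Y n))\<^sup>2)
        = (\<integral>\<^sup>+z. ennreal ((cmod (F z - rep_L2T (Y n) z))\<^sup>2) \<partial>circle_measure)"
      unfolding nn_integral_norm_square[symmetric]
      by (rule nn_integral_cong_AE) (use G[of n] in eventually_elim, simp)
    also have "\<dots> \<le> ennreal (e\<^sup>2)" by (rule bound[OF e])
    finally have "(norm (G - Y n))\<^sup>2 \<le> e\<^sup>2" by (subst (asm) ennreal_le_iff) auto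
    then show ?thesis using \<open>0 \<le> e\<close> by (rule power2_le_imp_le)
  qed
  have "Y \<longlonglongrightarrow> G"
  proof (rule LIMSEQ_I)
    fix e :: real assume "e > 0"
    then obtain N where N: "\<And>i j. i \<ge> N \<Longrightarrow> j \<ge> N \<Longrightarrow> norm (Y i - Y j) < e / 2"
      using \<open>Cauchy Y\<close> unfolding Cauchy_iff by (metis half_gt_zero)
    have "norm (Y n - G) < e" if "n \<ge> N" for n
    proof -
      have "norm (G - Y n) \<le> e / 2"
        by (rule norm_G[of N]) (rule less_imp_le[OF N[OF _ that]])
      then show ?thesis
        using \<open>e > 0\<close> by (simp add: norm_minus_commute)
    qed
    then show "\<exists>N. \<forall>n\<ge>N. norm (Y n - G) < e" by blast
  qed
  then have "X \<longlonglongrightarrow> G"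
    using Cauchy_converges_subseq[OF assms r(1)] by (simp add: Y_def)
  then show ?thesis by (auto simp: convergent_def)
qed

text \<open>By the parallelogram law, points of a subspace that nearly minimize the distance to \<open>x\<close> are
  close to each other, because their midpoint is not nearer to \<open>x\<close> than the infimum.\<close>

lemma complete_subspace_nearest:
  fixes S :: "'a::real_inner set"
  assumes "subspace S" "complete S"
  obtains y where "y \<in> S" "\<And>z. z \<in> S \<Longrightarrow> norm (x - y) \<le> norm (x - z)"
proof -
  define d where "d = (INF y\<in>S. (norm (x - y))\<^sup>2)"
  have ne: "S \<noteq> {}" using assms(1) subspace_0 by blast
  have bdd: "bdd_below ((\<lambda>y. (norm (x - y))\<^sup>2) ` S)"
    by (rule bdd_belowI[of _ 0]) auto
  have d_le: "d \<le> (norm (x - y))\<^sup>2" if "y \<in> S" for y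
    unfolding d_def using bdd that by (rule cINF_lower)
  have "\<exists>y\<in>S. (norm (x - y))\<^sup>2 < d + 1 / real (Suc n)" for n
    using cInf_lessD[of "(\<lambda>y. (norm (x - y))\<^sup>2) ` S" "d + 1 / real (Suc n)"] ne
    by (auto simp: d_def)
  then obtain Y where Y: "\<And>n. Y n \<in> S" "\<And>n. (norm (x - Y n))\<^sup>2 < d + 1 / real (Suc n)"
    by metis
  have close: "(norm (Y m - Y n))\<^sup>2 \<le> 4 / real (Suc N)" if "m \<ge> N" "n \<ge> N" for m n N
  proof -
    let ?c = "(1/2) *\<^sub>R (Y m + Y n)"
    have "?c \<in> S" using assms(1) Y(1) by (intro subspace_scale subspace_add)
    have "(norm (Y m - Y n))\<^sup>2 + 4 * (norm (x - ?c))\<^sup>2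
        = 2 * (norm (x - Y m))\<^sup>2 + 2 * (norm (x - Y n))\<^sup>2"
      by (simp add: power2_norm_eq_inner inner_commute algebra_simps)
    moreover have "1 / real (Suc m) \<le> 1 / real (Suc N)" "1 / real (Suc n) \<le> 1 / real (Suc N)"
      using that by (auto simp: frac_le)
    ultimately show ?thesis
      using d_le[OF \<open>?c \<in> S\<close>] Y(2)[of m] Y(2)[of n] by simp
  qed
  have "Cauchy Y"
  proof (rule CauchyI)
    fix e :: real assume "e > 0"
    then obtain N where N: "4 / e\<^sup>2 < real (Suc N)"
      by (metis less_Suc_eq of_nat_less_iff order_less_trans reals_Archimedean2)
    have "norm (Y m - Y n) < e" if "m \<ge> N" "n \<ge> N" for m n
    proof -
      have "4 / real (Suc N) < e\<^sup>2"
        using N \<open>e > 0\<close> by (simp add: field_simps)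
      with close[OF that] have "(norm (Y m - Y n))\<^sup>2 < e\<^sup>2" by simp
      then show ?thesis using \<open>e > 0\<close> by (simp add: power2_less_imp_less)
    qed
    then show "\<exists>N. \<forall>m\<ge>N. \<forall>n\<ge>N. norm (Y m - Y n) < e" by blast
  qed
  then obtain y where y: "y \<in> S" "Y \<longlonglongrightarrow> y"
    using assms(2) Y(1) by (auto simp: complete_def)
  have "(\<lambda>n. (norm (x - Y n))\<^sup>2) \<longlonglongrightarrow> (norm (x - y))\<^sup>2"
    using y(2) by (intro tendsto_intros)
  moreover have "(\<lambda>n. d + 1 / real (Suc n)) \<longlonglongrightarrow> d + 0"
    by (intro tendsto_intros LIMSEQ_inverse_real_of_nat[unfolded inverse_eq_divide])
  ultimately have "(norm (x - y))\<^sup>2 \<le> d"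
    using Y(2) by (auto intro: LIMSEQ_le less_imp_le)
  then have "norm (x - y) \<le> norm (x - z)" if "z \<in> S" for z
    using d_le[OF that] by (simp add: power2_le_imp_le)
  then show ?thesis using that y(1) by blast
qed

lemma complete_subspace_orthogonal:
  fixes S :: "'a::real_inner set"
  assumes "subspace S" "complete S"
  obtains y where "y \<in> S" "\<And>z. z \<in> S \<Longrightarrow> inner (x - y) z = 0"
proof -
  obtain y where y: "y \<in> S" "\<And>z. z \<in> S \<Longrightarrow> norm (x - y) \<le> norm (x - z)"
    using complete_subspace_nearest[OF assms, of x] by blast
  have "inner (x - y) z = 0" if "z \<in> S" for z
  proof (rule ccontr)
    assume ne: "inner (x - y) z \<noteq> 0"
    then have "z \<noteq> 0" by auto
    \<comment> \<open>Moving \<open>y\<close> along \<open>z\<close> by this amount minimizes the distance on that line.\<close>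
    define t where "t = inner (x - y) z / inner z z"
    have "y + t *\<^sub>R z \<in> S" using assms(1) y(1) that by (intro subspace_add subspace_scale)
    from y(2)[OF this] have "(norm (x - y))\<^sup>2 \<le> (norm ((x - y) - t *\<^sub>R z))\<^sup>2"
      by (simp add: power_mono diff_diff_eq)
    also have "\<dots> = (norm (x - y))\<^sup>2 - 2 * t * inner (x - y) z + t\<^sup>2 * inner z z"
    proof -
      have "(norm (w - t *\<^sub>R z))\<^sup>2 = (norm w)\<^sup>2 - 2 * t * inner w z + t\<^sup>2 * inner z z" for w
        using inner_commute[of z w]
        unfolding power2_norm_eq_inner
        by (simp add: inner_diff_left inner_diff_right power2_eq_square right_diff_distrib)
      then show ?thesis .
    qed
    also have "\<dots> = (norm (x - y))\<^sup>2 - (inner (x - y) z)\<^sup>2 / inner z z"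
      using \<open>z \<noteq> 0\<close> by (simp add: t_def power2_eq_square field_simps)
    finally have "(inner (x - y) z)\<^sup>2 / inner z z \<le> 0" by simp
    moreover have "(inner (x - y) z)\<^sup>2 / inner z z > 0"
      using ne \<open>z \<noteq> 0\<close> by (intro divide_pos_pos) auto
    ultimately show False by simp
  qed
  then show ?thesis using that y(1) by blast
qed

text \<open>Orthogonality for the real inner product, which is the real part of \<open>cip\<close>, gives complex
  orthogonality, because a complex subspace contains \<open>\<i> g\<close> together with \<open>g\<close>.\<close>

lemma closed_subspace_projection:
  assumes "L2T.subspace M" "closed M"
  obtains m where "m \<in> M" "f - m \<in> ortho_compl M"
proof -
  have "subspace M"
    using assms(1) by (auto simp: subspace_def L2T.subspace_def scaleR_L2T_def)
  moreover have "complete (UNIV :: L2T set)"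
    using L2T_Cauchy_convergent by (auto simp: complete_def convergent_def)
  then have "complete M"
    using complete_Int_closed[of UNIV M] assms(2) by simp
  ultimately obtain m where m: "m \<in> M" "\<And>g. g \<in> M \<Longrightarrow> inner (f - m) g = 0"
    using complete_subspace_orthogonal by metis
  have "cip (f - m) g = 0" if "g \<in> M" for g
  proof (rule complex_eqI)
    show "Re (cip (f - m) g) = Re 0"
      using m(2)[OF that] by (simp add: inner_L2T_def)
    have "cscale \<i> g \<in> M" using assms(1) that by (simp add: L2T.subspace_def)
    from m(2)[OF this] show "Im (cip (f - m) g) = Im 0"
      by (simp add: inner_L2T_def cip_cscale_right)
  qed
  then show ?thesis using that m(1) by (simp add: ortho_compl_def)
qed

lemma ortho_proj_eqI:
  assumes "L2T.subspace A" "g \<in> A" "f - g \<in> ortho_compl A"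
  shows "ortho_proj A f = g"
  unfolding ortho_proj_def
proof (rule the_equality)
  fix g' assume g': "g' \<in> A \<and> f - g' \<in> ortho_compl A"
  have "g' - g \<in> A"
    using g' assms by (intro L2T.subspace_diff) auto
  moreover have "cip (g' - g) k = 0" if "k \<in> A" for k
  proof -
    have "cip (f - g') k = 0" "cip (f - g) k = 0"
      using g' assms(3) that by (auto simp: ortho_compl_def)
    then show ?thesis by (simp add: cip_diff_left)
  qed
  ultimately show "g' = g" using cip_self_eq_0[of "g' - g"] by simp
qed (use assms in auto)

locale closed_L2T_subspace =
  fixes M :: "L2T set"
  assumes subspace: "L2T.subspace M" and closed: "closed M"
begin

text \<open>The condition \<open>f - g \<in> M\<close> stands in for membership in the double orthogonal complement; it is
  what makes linearity of the projection immediate.\<close>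

lemma compl_proj_eqI:
  assumes "g \<in> ortho_compl M" "f - g \<in> M"
  shows "compl_proj M f = g"
  unfolding compl_proj_def
proof (rule ortho_proj_eqI)
  show "f - g \<in> ortho_compl (ortho_compl M)"
    using assms(2) by (auto simp: ortho_compl_def intro: cip_eq_0_commute)
qed (use assms(1) subspace_ortho_compl in auto)

lemma compl_proj:
  shows compl_proj_in: "compl_proj M f \<in> ortho_compl M"
    and diff_compl_proj_in: "f - compl_proj M f \<in> M"
proof -
  obtain m where m: "m \<in> M" "f - m \<in> ortho_compl M"
    using closed_subspace_projection[OF subspace closed] .
  then have "compl_proj M f = f - m" by (intro compl_proj_eqI) auto
  with m show "compl_proj M f \<in> ortho_compl M" "f - compl_proj M f \<in> M" by simp_all
qed

lemma compl_proj_diff: "compl_proj M (f - g) = compl_proj M f - compl_proj M g"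
proof (rule compl_proj_eqI)
  show "compl_proj M f - compl_proj M g \<in> ortho_compl M"
    by (intro L2T.subspace_diff subspace_ortho_compl compl_proj_in)
  have "(f - compl_proj M f) - (g - compl_proj M g) \<in> M"
    by (intro L2T.subspace_diff subspace diff_compl_proj_in)
  then show "f - g - (compl_proj M f - compl_proj M g) \<in> M"
    by (simp add: algebra_simps)
qed

lemma compl_proj_cscale: "compl_proj M (cscale c f) = cscale c (compl_proj M f)"
proof (rule compl_proj_eqI)
  show "cscale c (compl_proj M f) \<in> ortho_compl M"
    by (intro L2T.subspace_scale subspace_ortho_compl compl_proj_in)
  show "cscale c f - cscale c (compl_proj M f) \<in> M"
    unfolding L2T.scale_right_diff_distrib[symmetric]
    by (intro L2T.subspace_scale subspace diff_compl_proj_in)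
qed

lemma compl_proj_eq_0: "f \<in> M \<Longrightarrow> compl_proj M f = 0"
  by (rule compl_proj_eqI) (auto intro: L2T.subspace_0 subspace_ortho_compl)

lemma cip_compl_proj_left:
  assumes "y \<in> ortho_compl M"
  shows "cip (compl_proj M f) y = cip f y"
proof -
  have "cip y (f - compl_proj M f) = 0"
    using assms diff_compl_proj_in by (auto simp: ortho_compl_def)
  then have "cip (f - compl_proj M f) y = 0"
    by (rule cip_eq_0_commute)
  then show ?thesis by (simp add: cip_diff_left)
qed

lemma cip_diff_compl_proj:
  assumes "g \<in> M"
  shows "cip (f - compl_proj M f) g = cip f g"
  using compl_proj_in[of f] assms by (simp add: ortho_compl_def cip_diff_left)

text \<open>The adjoint of the compression of multiplication by \<open>z\<close> is the compression of multiplication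
  by \<open>cnj z\<close>, since the projection can be dropped against vectors of the complement.\<close>

lemma dual_shift_adj_eq:
  assumes "y \<in> ortho_compl M"
  shows "dual_shift_adj M y = compl_proj M (mult_op cnj y)"
  unfolding dual_shift_adj_def adjoint_on_def
proof (rule the_equality)
  let ?w = "compl_proj M (mult_op cnj y)"
  have adj: "cip (dual_shift M x) y = cip x ?w" if "x \<in> ortho_compl M" for x
  proof -
    have "cip (dual_shift M x) y = cip x (mult_op cnj y)"
      using assms
      by (simp add: dual_shift_def dual_op_def cip_compl_proj_left cip_mult_op_left[OF L_infinity_id])
    also have "\<dots> = cip x ?w"
      using cip_compl_proj_left[OF that, of "mult_op cnj y"]
        cip_commute[of x "mult_op cnj y"] cip_commute[of x ?w] by simp
    finally show ?thesis .
  qed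
  then show "?w \<in> ortho_compl M \<and> (\<forall>x\<in>ortho_compl M. cip (dual_shift M x) y = cip x ?w)"
    using compl_proj_in by simp
  fix w assume w: "w \<in> ortho_compl M \<and> (\<forall>x\<in>ortho_compl M. cip (dual_shift M x) y = cip x w)"
  have "w - ?w \<in> ortho_compl M"
    using w compl_proj_in by (intro L2T.subspace_diff subspace_ortho_compl) auto
  then have "cip (w - ?w) (w - ?w) = 0"
    using w adj by (simp add: cip_diff_right)
  then show "w = ?w" using cip_self_eq_0 by fastforce
qed

end

section \<open>Nearly invariant subspaces\<close>

lemma hardy_eval_0: "hardy_eval f 0 = fourier_coeff f 0"
  unfolding hardy_eval_def by (subst powser_zero) simp

lemma fourier_coeff_0_eq_cip: "fourier_coeff f 0 = cip f (to_L2T (\<lambda>_. 1))"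
proof -
  from rep_to_L2T[OF square_integrable_one] show ?thesis
    unfolding fourier_coeff_eq_integral cip_eq_integral
    by (intro integral_cong_AE borel_measurable_mult_cnj rep_measurable) (auto)
qed

text \<open>On the unit circle \<open>1 / z = cnj z\<close>.\<close>

lemma backward_shift_eq:
  assumes "hardy_eval f 0 = 0"
  shows "backward_shift f = mult_op cnj f"
proof -
  have "to_L2T (\<lambda>_. 0) = 0"
    using rep_to_L2T[OF square_integrable_zero] rep_abs[OF square_integrable_zero]
    unfolding L2T_eq_iff zero_L2T_def by eventually_elim simp
  moreover have eq: "AE z in circle_measure. 1 / z = cnj z"
    using AE_circle_norm by eventually_elim (simp add: divide_conv_cnj)
  have "(\<lambda>z. 1 / z) \<in> L_infinity"
  proof -
    have "(\<lambda>z. 1 / z) \<in> borel_measurable circle_measure"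
      using measurable_powi_circle[of "-1"] by (simp add: divide_inverse power_int_minus)
    moreover have "AE z in circle_measure. cmod (1 / z) \<le> 1"
      using AE_circle_norm by eventually_elim (simp add: norm_divide)
    ultimately show ?thesis by (auto simp: L_infinity_def)
  qed
  ultimately show ?thesis
    unfolding backward_shift_def assms
    by (simp add: mult_op_cong[OF _ L_infinity_cnj_id eq])
qed

locale extremal_nearly_invariant =
  fixes M :: "L2T set" and h :: L2T
  assumes nearly_invariant: "nearly_invariant M" and extremal: "extremal_function M h"

sublocale extremal_nearly_invariant \<subseteq> closed_L2T_subspace M
  using nearly_invariant by unfold_locales (auto simp: nearly_invariant_def)

context extremal_nearly_invariant
begin

lemma h_in: "h \<in> M" and cip_h_h: "cip h h = 1"
  using extremal by (auto simp: extremal_function_def cip_self)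

text \<open>Subtracting the multiple of \<open>h\<close> with the same value at \<open>0\<close> leaves an element of \<open>M\<close> that
  vanishes at \<open>0\<close> and hence is orthogonal to \<open>h\<close>. As \<open>m\<close> itself is orthogonal to \<open>h\<close>, that multiple
  is zero, so \<open>m(0) = 0\<close> and near invariance applies.\<close>

lemma conj_mult_in:
  assumes "m \<in> M" "cip m h = 0"
  shows "mult_op cnj m \<in> M"
proof -
  define c where "c = hardy_eval m 0 / hardy_eval h 0"
  have "hardy_eval h 0 \<noteq> 0" using extremal by (auto simp: extremal_function_def)
  then have "hardy_eval (m - cscale c h) 0 = 0"
    by (simp add: hardy_eval_0 fourier_coeff_0_eq_cip cip_diff_left cip_cscale_left c_def)
  moreover have "m - cscale c h \<in> M"
    by (intro L2T.subspace_diff L2T.subspace_scale subspace assms h_in)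
  ultimately have "cip h (m - cscale c h) = 0"
    using extremal by (simp add: extremal_function_def)
  moreover have "cip h m = 0" using assms(2) by (rule cip_eq_0_commute)
  ultimately have "c = 0" by (simp add: cip_diff_right cip_cscale_right cip_h_h)
  then have "hardy_eval m 0 = 0" using \<open>hardy_eval h 0 \<noteq> 0\<close> by (simp add: c_def)
  then show ?thesis
    using nearly_invariant assms(1) backward_shift_eq[of m] by (metis nearly_invariant_def)
qed

text \<open>The component of \<open>f\<close> along \<open>M\<close> differs from \<open>\<langle>f, h\<rangle> h\<close> by an element of \<open>M\<close> orthogonal to \<open>h\<close>,
  which multiplication by \<open>cnj z\<close> keeps in \<open>M\<close>.\<close>

lemma compl_proj_conj_proj:
  "compl_proj M (mult_op cnj (f - compl_proj M f)) = cscale (cip f h) (compl_proj M (mult_op cnj h))"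
proof -
  let ?q = "f - compl_proj M f"
  have "?q - cscale (cip f h) h \<in> M"
    by (intro L2T.subspace_diff[OF subspace] L2T.subspace_scale[OF subspace] diff_compl_proj_in h_in)
  moreover have "cip (?q - cscale (cip f h) h) h = 0"
    using cip_diff_compl_proj[OF h_in, of f]
    by (simp add: cip_diff_left[of ?q] cip_cscale_left cip_h_h)
  ultimately have "compl_proj M (mult_op cnj (?q - cscale (cip f h) h)) = 0"
    by (intro compl_proj_eq_0 conj_mult_in)
  then show ?thesis
    by (simp add: mult_op_diff[OF L_infinity_cnj_id, of ?q] mult_op_cscale[OF L_infinity_cnj_id]
        compl_proj_diff compl_proj_cscale del: minus_diff_eq diff_diff_eq)
qed

text \<open>Only a multiple of \<open>h\<close> has to be removed from \<open>z x\<close>: an element \<open>m\<close> of \<open>M\<close> orthogonal to \<open>h\<close>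
  satisfies \<open>\<langle>z x, m\<rangle> = \<langle>x, cnj z m\<rangle> = 0\<close>, as \<open>cnj z m \<in> M\<close>. The proof applies this to the
  candidate \<open>m\<close> for the remainder, which turns out to be orthogonal to itself.\<close>

lemma dual_shift_eq:
  assumes "x \<in> ortho_compl M"
  shows "dual_shift M x = mult_op (\<lambda>z. z) x - cscale (cip x (mult_op cnj h)) h"
proof -
  let ?y = "mult_op (\<lambda>z. z) x"
  let ?m = "?y - compl_proj M ?y - cscale (cip ?y h) h"
  have m: "?m \<in> M"
    by (intro L2T.subspace_diff[OF subspace] L2T.subspace_scale[OF subspace] diff_compl_proj_in h_in)
  have mh: "cip ?m h = 0"
    using cip_diff_compl_proj[OF h_in, of ?y]
    by (simp add: cip_diff_left[of "?y - _"] cip_cscale_left cip_h_h)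
  have "cip ?y ?m = cip x (mult_op cnj ?m)"
    by (simp add: cip_mult_op_left[OF L_infinity_id])
  also have "\<dots> = 0"
    using assms conj_mult_in[OF m mh] by (simp add: ortho_compl_def)
  finally have "cip (?y - compl_proj M ?y) ?m = 0"
    by (simp only: cip_diff_compl_proj[OF m])
  moreover have "cip h ?m = 0" using mh by (rule cip_eq_0_commute)
  ultimately have "cip ?m ?m = 0"
    by (simp only: cip_diff_left[of "?y - _" _ ?m] cip_cscale_left) simp
  then have "?m = 0" by (rule cip_self_eq_0)
  then show ?thesis
    by (simp add: dual_shift_def dual_op_def cip_mult_op_left[OF L_infinity_id] algebra_simps)
qed

text \<open>With \<open>y = \<phi> z x\<close>, so that \<open>cnj z y = \<phi> x\<close>, the first rank one term is the loss from replacing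
  \<open>y\<close> by its projection, and the second is the loss from replacing \<open>z x\<close> by its projection.\<close>

lemma dual_op_commutation_defect:
  assumes \<phi>: "\<phi> \<in> L_infinity" and x: "x \<in> ortho_compl M"
  shows "dual_shift_adj M (dual_op M \<phi> (dual_shift M x)) - dual_op M \<phi> x =
    - rank_one (compl_proj M (mult_op cnj h)) (mult_op (\<lambda>z. cnj z * cnj (\<phi> z)) h) x
    - rank_one (dual_shift_adj M (compl_proj M (mult_op \<phi> h))) (mult_op cnj h) x"
proof -
  let ?P = "compl_proj M" and ?c = "cip x (mult_op cnj h)"
  define y where "y = mult_op \<phi> (mult_op (\<lambda>z. z) x)"
  have "mult_op cnj y = mult_op (\<lambda>z. cnj z * (\<phi> z * z)) x"
    unfolding y_def
    by (simp add: mult_op_mult_op \<phi> L_infinity_id L_infinity_cnj_id L_infinity_mult)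
  also have "\<dots> = mult_op \<phi> x"
  proof (rule mult_op_cong)
    show "AE z in circle_measure. cnj z * (\<phi> z * z) = \<phi> z"
      using AE_circle_norm
    proof eventually_elim
      case (elim z)
      have "cnj z * (\<phi> z * z) = \<phi> z * (z * cnj z)" by (simp add: algebra_simps)
      also have "\<dots> = \<phi> z" using elim by (simp add: complex_norm_square[symmetric])
      finally show ?case .
    qed
  qed (simp_all add: \<phi> L_infinity_id L_infinity_cnj_id L_infinity_mult)
  finally have y: "mult_op cnj y = mult_op \<phi> x" .
  have "cip y h = cip x (mult_op (\<lambda>z. cnj z) (mult_op (\<lambda>z. cnj (\<phi> z)) h))"
    unfolding y_def by (simp add: cip_mult_op_left \<phi> L_infinity_id)
  then have yh: "cip y h = cip x (mult_op (\<lambda>z. cnj z * cnj (\<phi> z)) h)"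
    by (simp add: mult_op_mult_op \<phi> L_infinity_cnj_id L_infinity_cnj)
  have "?P y = y - (y - ?P y)" by simp
  then have "?P (mult_op cnj (?P y)) = ?P (mult_op cnj y) - ?P (mult_op cnj (y - ?P y))"
    by (metis mult_op_diff[OF L_infinity_cnj_id] compl_proj_diff)
  also have "\<dots> = dual_op M \<phi> x - cscale (cip y h) (?P (mult_op cnj h))"
    unfolding compl_proj_conj_proj y dual_op_def ..
  finally have Py: "?P (mult_op cnj (?P y)) = dual_op M \<phi> x - cscale (cip y h) (?P (mult_op cnj h))" .
  have "dual_op M \<phi> (dual_shift M x) = ?P y - cscale ?c (?P (mult_op \<phi> h))"
    by (simp add: dual_op_def dual_shift_eq[OF x] mult_op_diff[OF \<phi>] mult_op_cscale[OF \<phi>]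
        compl_proj_diff compl_proj_cscale y_def)
  moreover have "\<dots> \<in> ortho_compl M"
    by (intro L2T.subspace_diff L2T.subspace_scale subspace_ortho_compl compl_proj_in)
  ultimately have "dual_shift_adj M (dual_op M \<phi> (dual_shift M x))
      = ?P (mult_op cnj (?P y)) - cscale ?c (?P (mult_op cnj (?P (mult_op \<phi> h))))"
    by (simp add: dual_shift_adj_eq mult_op_diff[OF L_infinity_cnj_id] mult_op_cscale[OF L_infinity_cnj_id]
        compl_proj_diff compl_proj_cscale)
  then show ?thesis
    by (simp add: Py yh rank_one_def dual_shift_adj_eq compl_proj_in)
qed

end

section \<open>The inner function\<close>

text \<open>Multiplication by \<open>cnj z\<close> shifts Fourier coefficients by one, so \<open>u(0) = 0\<close> keeps \<open>cnj z u\<close> in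
  \<open>H2\<close>. As \<open>u\<close> is unimodular, \<open>\<langle>cnj z u, u g\<rangle> = \<langle>cnj z, g\<rangle>\<close>, the conjugate of the Fourier
  coefficient of \<open>g\<close> at \<open>-1\<close>.\<close>

lemma conj_inner_in_model_space:
  assumes u: "inner_function u" and u0: "hardy_eval (to_L2T u) 0 = 0"
  shows "mult_op cnj (to_L2T u) \<in> model_space u"
proof -
  have uL: "u \<in> L_infinity" and uH: "to_L2T u \<in> H2"
    and u1: "AE z in circle_measure. cmod (u z) = 1"
    using u by (auto simp: inner_function_def)
  note rep_u = rep_to_L2T[OF square_integrable_L_infinity[OF uL]]
  let ?k = "mult_op cnj (to_L2T u)"
  have rep_k: "AE z in circle_measure. rep_L2T ?k z = cnj z * u z"
    using rep_mult_op[OF L_infinity_cnj_id, of "to_L2T u"] rep_u by eventually_elim simp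
  have "fourier_coeff ?k n = fourier_coeff (to_L2T u) (n + 1)" for n
    unfolding fourier_coeff_eq_integral
  proof (rule integral_cong_AE)
    show "AE z in circle_measure. rep_L2T ?k z * cnj (z powi n)
        = rep_L2T (to_L2T u) z * cnj (z powi (n + 1))"
      using rep_k rep_u AE_circle_norm
    proof eventually_elim
      case (elim z)
      then have "z \<noteq> 0" by auto
      then show ?case using elim by (simp add: power_int_add)
    qed
  qed (intro borel_measurable_mult_cnj measurable_powi_circle rep_measurable)+
  moreover have "fourier_coeff (to_L2T u) n = 0" if "n \<le> 0" for n
    using uH u0 that by (cases "n = 0") (auto simp: H2_def hardy_eval_0)
  ultimately have "?k \<in> H2" by (simp add: H2_def)
  moreover have "cip ?k (mult_op u g) = 0" if "g \<in> H2" for g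
  proof -
    have "cip ?k (mult_op u g) = cnj (fourier_coeff g (- 1))"
      unfolding cip_eq_integral fourier_coeff_eq_integral Bochner_Integration.integral_cnj[symmetric]
    proof (rule integral_cong_AE)
      show "AE z in circle_measure. rep_L2T ?k z * cnj (rep_L2T (mult_op u g) z)
          = cnj (rep_L2T g z * cnj (z powi - 1))"
        using rep_k rep_mult_op[OF uL, of g] u1 AE_circle_norm
      proof eventually_elim
        case (elim z)
        have "inverse z = cnj z"
          using elim(4) by (simp add: inverse_eq_divide divide_conv_cnj)
        moreover have "u z * cnj (u z) = 1"
          using elim(3) by (simp add: complex_norm_square[symmetric])
        ultimately show ?case
          using elim(1,2) by (simp add: power_int_minus algebra_simps)
      qed
      show "(\<lambda>z. cnj (rep_L2T g z * cnj (z powi - 1))) \<in> borel_measurable circle_measure"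
        using borel_measurable_mult_cnj[OF measurable_powi_circle[of "-1"] rep_measurable[of g]]
        by (simp add: mult.commute)
    qed (intro borel_measurable_mult_cnj rep_measurable)
    then show ?thesis using that by (simp add: H2_def)
  qed
  ultimately show ?thesis by (auto simp: model_space_def ortho_compl_def)
qed

text \<open>The product of \<open>h\<close> with the element \<open>cnj z u\<close> of the model space can be formed in either
  order: as the multiplier \<open>h\<close> acting on that element, or as a bounded function acting on \<open>h\<close>.\<close>

lemma conj_inner_mult_in:
  assumes u: "inner_function u" and u0: "hardy_eval (to_L2T u) 0 = 0"
    and h: "isometric_multiplier h (model_space u) M"
  shows "mult_op (\<lambda>z. cnj z * u z) h \<in> M"
proof -
  have uL: "u \<in> L_infinity"
    using u by (simp add: inner_function_def)
  let ?k = "mult_op cnj (to_L2T u)"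
  note k = conj_inner_in_model_space[OF u u0]
  note rep_u = rep_to_L2T[OF square_integrable_L_infinity[OF uL]]
  have "square_integrable (\<lambda>z. rep_L2T h z * rep_L2T ?k z)"
    using h k by (simp add: isometric_multiplier_def)
  from rep_to_L2T[OF this] have "mult_op (rep_L2T h) ?k = mult_op (\<lambda>z. cnj z * u z) h"
    unfolding L2T_eq_iff mult_op_def[of "rep_L2T h"]
    using rep_mult_op[OF L_infinity_mult[OF L_infinity_cnj_id uL], of h]
      rep_mult_op[OF L_infinity_cnj_id, of "to_L2T u"] rep_u
    by eventually_elim simp
  moreover have "mult_op (rep_L2T h) ?k \<in> M"
    using h k by (auto simp: isometric_multiplier_def)
  ultimately show ?thesis by simp
qed

section \<open>The displacement formula\<close>

lemma rank_on_le_card: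
  assumes "finite B" "T ` A \<subseteq> L2T.span B"
  shows "rank_on A T \<le> enat (card B)"
  using assms L2T.dim_le_card[OF assms(2,1)] by (auto simp: rank_on_def)

theorem theorem5p2:
  fixes M :: "L2T set" and h :: L2T and u \<phi> :: "complex \<Rightarrow> complex"
  assumes "nearly_invariant M" and "M \<noteq> {0}" and "M \<noteq> H2"
    and "inner_function u"
    and "\<not> (\<exists>c. AE z in circle_measure. u z = c)"
    and "hardy_eval (to_L2T u) 0 = 0"
    and "extremal_function M h"
    and "isometric_multiplier h (model_space u) M"
    and "\<phi> \<in> L_infinity"
  shows
    "let P = compl_proj M; D = dual_op M \<phi>; S = dual_shift M; Sa = dual_shift_adj M;
         \<Delta>1 = (\<lambda>x. - rank_one (P (mult_op cnj h)) (mult_op (\<lambda>z. cnj z * cnj (\<phi> z)) h) x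
                   + rank_one (P (mult_op (\<lambda>z. cnj z * u z) h))
                       (mult_op (\<lambda>z. cnj z * cnj (\<phi> z) * u z) h) x);
         \<Delta>2 = (\<lambda>x. - rank_one (Sa (P (mult_op \<phi> h))) (mult_op cnj h) x
                   + rank_one (Sa (P (mult_op (\<lambda>z. \<phi> z * u z) h)))
                       (mult_op (\<lambda>z. cnj z * u z) h) x)
     in (\<forall>x \<in> ortho_compl M. Sa (D (S x)) - D x = \<Delta>1 x + \<Delta>2 x)
        \<and> rank_on (ortho_compl M) (\<lambda>x. Sa (D (S x)) - D x) \<le> 4"
proof -
  interpret extremal_nearly_invariant M h
    using assms by unfold_locales
  let ?P = "compl_proj M" and ?Sa = "dual_shift_adj M"
  let ?T = "\<lambda>x. ?Sa (dual_op M \<phi> (dual_shift M x)) - dual_op M \<phi> x"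
  let ?a1 = "?P (mult_op cnj h)" and ?b1 = "mult_op (\<lambda>z. cnj z * cnj (\<phi> z)) h"
  let ?a2 = "?P (mult_op (\<lambda>z. cnj z * u z) h)"
  let ?b2 = "mult_op (\<lambda>z. cnj z * cnj (\<phi> z) * u z) h"
  let ?a3 = "?Sa (?P (mult_op \<phi> h))" and ?a4 = "?Sa (?P (mult_op (\<lambda>z. \<phi> z * u z) h))"
  let ?b4 = "mult_op (\<lambda>z. cnj z * u z) h"
  have b4: "?b4 \<in> M" using assms by (intro conj_inner_mult_in)
  have formula: "?T x = (- rank_one ?a1 ?b1 x + rank_one ?a2 ?b2 x)
      + (- rank_one ?a3 (mult_op cnj h) x + rank_one ?a4 ?b4 x)" if x: "x \<in> ortho_compl M" for x
  proof -
    have "rank_one ?a2 ?b2 x = 0" using compl_proj_eq_0[OF b4] by (simp add: rank_one_def)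
    moreover have "rank_one ?a4 ?b4 x = 0"
      using x b4 by (simp add: rank_one_def ortho_compl_def)
    ultimately show ?thesis
      using dual_op_commutation_defect[OF \<open>\<phi> \<in> L_infinity\<close> x] by simp
  qed
  let ?B = "{?a1, ?a2, ?a3, ?a4}"
  have "?T x \<in> L2T.span ?B" if x: "x \<in> ortho_compl M" for x
    unfolding formula[OF x] rank_one_def
    by (intro L2T.span_add L2T.span_neg L2T.span_scale L2T.span_base) auto
  then have "rank_on (ortho_compl M) ?T \<le> enat (card ?B)"
    by (intro rank_on_le_card) auto
  also have "card ?B \<le> 4"
    using card_length[of "[?a1, ?a2, ?a3, ?a4]"] by simp
  then have "enat (card ?B) \<le> 4"
    by (simp add: numeral_eq_enat)
  finally show ?thesis
    using formula by (simp add: Let_def)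
qed

end
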